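(* Let $f$ and $F$ be two harmonic mappings in $\mathbb{D}$ with $f\preceq F$. If $F\in\mathcal{B}_H(1)$, then $f\in\mathcal{B}_H(1)$; and if $F\in\mathcal{B}^*_H(1)$, then $f\in\mathcal{B}^*_H(1)$. In particular, if $f\preceq F$ and $F\in\mathcal{B}(1)$, then $f\in\mathcal{B}(1)$.
   Context: $\mathbb{D}$ is the open unit disk in $\mathbb{C}$. A harmonic mapping in $\mathbb{D}$ is a complex-valued $f$ with $f_{z\overline z}=0$; it decomposes as $f=h+\overline g$ with $h,g$ analytic in $\mathbb{D}$, $g(0)=0$. Its Jacobian is $J_f=|h'|^2-|g'|^2$. $f\preceq F$ means that there is an analytic function $\phi:\mathbb{D}\to\mathbb{D}$ (not necessarily fixing $0$) such that $f=F\circ\phi$. $\mathcal{B}_H(1)$ is the set of harmonic mappings $f=h+\overline g$ in $\mathbb{D}$ with $\sup_{z\in\mathbb{D}}(1-|z|^2)(|h'(z)|+|g'(z)|)<\infty$; $\mathcal{B}(1)$ is the set of analytic functions in $\mathcal{B}_H(1)$ (i.e. $g\equiv0$); $\mathcal{B}^*_H(1)$ is the set of harmonic mappings $f$ in $\mathbb{D}$ with $\sup_{z\in\mathbb{D}}(1-|z|^2)\sqrt{|J_f(z)|}<\infty$. *)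

theory Defs
  imports "HOL-Complex_Analysis.Complex_Analysis"
begin

abbreviation unit_disk :: "complex set" where
  "unit_disk \<equiv> ball 0 1"

text \<open>The Wirtinger derivatives, with \<^term>\<open>frechet_derivative f (at z)\<close> the real differential:
  \<open>f\<^sub>z = (f\<^sub>x - \<i> f\<^sub>y) / 2\<close> and the conjugate one \<open>(f\<^sub>x + \<i> f\<^sub>y) / 2\<close>.\<close>

definition wirtinger :: "(complex \<Rightarrow> complex) \<Rightarrow> complex \<Rightarrow> complex" where
  "wirtinger f z =
     (frechet_derivative f (at z) 1 - \<i> * frechet_derivative f (at z) \<i>) / 2"

definition wirtinger_bar :: "(complex \<Rightarrow> complex) \<Rightarrow> complex \<Rightarrow> complex" where
  "wirtinger_bar f z =
     (frechet_derivative f (at z) 1 + \<i> * frechet_derivative f (at z) \<i>) / 2"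

text \<open>Twice continuous differentiability in the real sense, expressed through the Wirtinger
  derivatives, which are invertible linear combinations of the partial derivatives.\<close>

definition real_C2_on :: "complex set \<Rightarrow> (complex \<Rightarrow> complex) \<Rightarrow> bool" where
  "real_C2_on S f \<longleftrightarrow>
     f differentiable_on S \<and>
     wirtinger f differentiable_on S \<and> wirtinger_bar f differentiable_on S \<and>
     continuous_on S (wirtinger (wirtinger f)) \<and>
     continuous_on S (wirtinger_bar (wirtinger f)) \<and>
     continuous_on S (wirtinger (wirtinger_bar f)) \<and>
     continuous_on S (wirtinger_bar (wirtinger_bar f))"

definition harmonic_mapping :: "(complex \<Rightarrow> complex) \<Rightarrow> bool" where
  "harmonic_mapping f \<longleftrightarrow>
     real_C2_on unit_disk f \<and> (\<forall>z\<in>unit_disk. wirtinger_bar (wirtinger f) z = 0)"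

definition canonical_decomp ::
    "(complex \<Rightarrow> complex) \<Rightarrow> (complex \<Rightarrow> complex) \<Rightarrow> (complex \<Rightarrow> complex) \<Rightarrow> bool" where
  "canonical_decomp f h g \<longleftrightarrow>
     h holomorphic_on unit_disk \<and> g holomorphic_on unit_disk \<and> g 0 = 0 \<and>
     (\<forall>z\<in>unit_disk. f z = h z + cnj (g z))"

lemma wirtinger_eqs:
  assumes "(f has_derivative f') (at z)"
  shows "f' w = wirtinger f z * w + wirtinger_bar f z * cnj w"
proof -
  have eq: "frechet_derivative f (at z) = f'"
    using frechet_derivative_at[OF assms] by simp
  have lin: "linear f'"
    using assms has_derivative_linear by blast
  have "w = Re w *\<^sub>R 1 + Im w *\<^sub>R \<i>"
    by (simp add: complex_eq_iff)
  then have "f' w = f' (Re w *\<^sub>R 1 + Im w *\<^sub>R \<i>)"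
    by (rule arg_cong)
  also have "\<dots> = Re w *\<^sub>R f' 1 + Im w *\<^sub>R f' \<i>"
    by (simp only: linear_add[OF lin] linear_cmul[OF lin])
  also have "\<dots> = wirtinger f z * w + wirtinger_bar f z * cnj w"
    by (simp add: wirtinger_def wirtinger_bar_def eq complex_eq_iff field_simps)
  finally show ?thesis .
qed

lemma wirtinger_has_derivative:
  assumes "f differentiable_on S" "open S" "z \<in> S"
  shows "(f has_derivative (\<lambda>w. wirtinger f z * w + wirtinger_bar f z * cnj w)) (at z)"
proof -
  obtain f' where f': "(f has_derivative f') (at z)"
    using assms by (metis at_within_open differentiable_def differentiable_on_def)
  then have "f' = (\<lambda>w. wirtinger f z * w + wirtinger_bar f z * cnj w)"
    using wirtinger_eqs by blast
  with f' show ?thesis by simp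
qed

lemma canonical_decomp_exists:
  assumes "harmonic_mapping f"
  shows "\<exists>h g. canonical_decomp f h g"
proof -
  have f: "f differentiable_on unit_disk" and p: "wirtinger f differentiable_on unit_disk"
    and 0: "\<And>z. z \<in> unit_disk \<Longrightarrow> wirtinger_bar (wirtinger f) z = 0"
    using assms by (auto simp: harmonic_mapping_def real_C2_on_def)
  have "wirtinger f holomorphic_on unit_disk"
    unfolding holomorphic_on_open[OF open_ball] has_field_derivative_def
  proof (intro ballI exI)
    fix z assume z: "z \<in> unit_disk"
    show "(wirtinger f has_derivative (*) (wirtinger (wirtinger f) z)) (at z)"
      using wirtinger_has_derivative[OF p open_ball z] 0[OF z] by simp
  qed
  then obtain h where h: "\<And>z. z \<in> unit_disk \<Longrightarrow> (h has_field_derivative wirtinger f z) (at z)"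
    using holomorphic_convex_primitive'[of unit_disk "wirtinger f"]
    by (metis at_within_open convex_ball open_ball)
  define g where "g z = cnj (f z - h z)" for z
  have "(g has_field_derivative cnj (wirtinger_bar f z)) (at z)" if z: "z \<in> unit_disk" for z
  proof -
    have "((\<lambda>z. f z - h z) has_derivative (\<lambda>w. wirtinger_bar f z * cnj w)) (at z)"
      using has_derivative_diff[OF wirtinger_has_derivative[OF f open_ball z]
          h[OF z, unfolded has_field_derivative_def]]
      by simp
    from bounded_linear.has_derivative[OF bounded_linear_cnj this]
    show ?thesis
      by (simp add: has_field_derivative_def g_def[abs_def])
  qed
  then have "g holomorphic_on unit_disk" "h holomorphic_on unit_disk"
    unfolding holomorphic_on_open[OF open_ball] using h by blast+
  moreover have "f z = h z + cnj (g z)" for z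
    by (simp add: g_def)
  ultimately have "canonical_decomp f (\<lambda>z. h z + cnj (g 0)) (\<lambda>z. g z - g 0)"
    unfolding canonical_decomp_def
    by (auto intro!: holomorphic_intros)
  then show ?thesis by blast
qed

lemma canonical_decomp_unique:
  assumes 1: "canonical_decomp f h1 g1" and 2: "canonical_decomp f h2 g2" and z: "z \<in> unit_disk"
  shows "h1 z = h2 z" "g1 z = g2 z"
proof -
  define u v where "u w = h1 w - h2 w" and "v w = g2 w - g1 w" for w
  have u: "u holomorphic_on unit_disk" and v: "v holomorphic_on unit_disk"
    using 1 2 unfolding canonical_decomp_def u_def v_def
    by (auto intro!: holomorphic_intros)
  have uv: "u w = cnj (v w)" if "w \<in> unit_disk" for w
  proof -
    have "h1 w + cnj (g1 w) = h2 w + cnj (g2 w)"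
      using 1 2 that by (metis canonical_decomp_def)
    then show ?thesis by (simp add: u_def v_def algebra_simps)
  qed
  have d: "(u has_field_derivative 0) (at w within unit_disk)" if w: "w \<in> unit_disk" for w
  proof -
    obtain a b where a: "(u has_field_derivative a) (at w)" and b: "(v has_field_derivative b) (at w)"
      using u v w by (meson holomorphic_on_open open_ball)
    have "((\<lambda>w. cnj (v w)) has_derivative (\<lambda>x. cnj (b * x))) (at w)"
      by (rule bounded_linear.has_derivative[OF bounded_linear_cnj
            b[unfolded has_field_derivative_def]])
    then have "(u has_derivative (\<lambda>x. cnj (b * x))) (at w)"
      by (rule has_derivative_transform_within_open[OF _ open_ball w]) (simp add: uv)
    then have e: "(*) a = (\<lambda>x. cnj (b * x))"
      using a has_derivative_unique unfolding has_field_derivative_def by blast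
    have "a = 0"
      using fun_cong[OF e, of 1] fun_cong[OF e, of \<i>] by (auto simp: complex_eq_iff)
    then show ?thesis using a has_field_derivative_at_within by blast
  qed
  have "u z = u 0"
    using has_field_derivative_zero_constant[OF convex_ball d] z
    by (metis centre_in_ball zero_less_one)
  moreover have "v 0 = 0"
    using 1 2 by (simp add: canonical_decomp_def v_def)
  ultimately have "u z = 0" "v z = 0"
    using uv[OF z] uv[of 0] by simp_all
  then show "h1 z = h2 z" "g1 z = g2 z"
    by (simp_all add: u_def v_def)
qed

text \<open>By the preceding two lemmas the decomposition of a harmonic mapping exists and is unique on the
  disk, so the following description operators are well defined there.\<close>

definition analytic_part :: "(complex \<Rightarrow> complex) \<Rightarrow> complex \<Rightarrow> complex" where
  "analytic_part f = (SOME h. \<exists>g. canonical_decomp f h g)"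

definition coanalytic_part :: "(complex \<Rightarrow> complex) \<Rightarrow> complex \<Rightarrow> complex" where
  "coanalytic_part f = (SOME g. \<exists>h. canonical_decomp f h g)"

definition harmonic_jacobian :: "(complex \<Rightarrow> complex) \<Rightarrow> complex \<Rightarrow> real" where
  "harmonic_jacobian f z =
     (cmod (deriv (analytic_part f) z))\<^sup>2 - (cmod (deriv (coanalytic_part f) z))\<^sup>2"

definition harmonic_Bloch :: "(complex \<Rightarrow> complex) set" where
  "harmonic_Bloch = {f. harmonic_mapping f \<and>
     bdd_above ((\<lambda>z. (1 - (cmod z)\<^sup>2) *
       (cmod (deriv (analytic_part f) z) + cmod (deriv (coanalytic_part f) z))) ` unit_disk)}"

definition analytic_Bloch :: "(complex \<Rightarrow> complex) set" where
  "analytic_Bloch = {f \<in> harmonic_Bloch. f holomorphic_on unit_disk}"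

definition harmonic_Bloch_star :: "(complex \<Rightarrow> complex) set" where
  "harmonic_Bloch_star = {f. harmonic_mapping f \<and>
     bdd_above ((\<lambda>z. (1 - (cmod z)\<^sup>2) * sqrt \<bar>harmonic_jacobian f z\<bar>) ` unit_disk)}"

text \<open>The function \<open>\<phi>\<close> is not required to fix \<open>0\<close>.\<close>

definition subordinate :: "(complex \<Rightarrow> complex) \<Rightarrow> (complex \<Rightarrow> complex) \<Rightarrow> bool"
    (infix "\<preceq>" 50) where
  "f \<preceq> F \<longleftrightarrow>
     (\<exists>\<phi>. \<phi> holomorphic_on unit_disk \<and> \<phi> ` unit_disk \<subseteq> unit_disk \<and>
       (\<forall>z\<in>unit_disk. f z = F (\<phi> z)))"

end

theory Submission
  imports Defs
begin

text \<open>If \<open>F = H + cnj G\<close> and \<open>f = F \<circ> \<phi>\<close>, then the analytic and co-analytic parts of \<open>f\<close> are, up to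
  constants, \<open>H \<circ> \<phi>\<close> and \<open>G \<circ> \<phi>\<close>. Hence both Bloch densities of \<open>f\<close> at \<open>z\<close> are those of \<open>F\<close> at
  \<open>\<phi> z\<close> times \<open>\<bar>\<phi>' z\<bar>\<close>, and the Schwarz--Pick inequality
  \<open>(1 - \<bar>z\<bar>\<^sup>2) \<bar>\<phi>' z\<bar> \<le> 1 - \<bar>\<phi> z\<bar>\<^sup>2\<close> shows that the suprema do not increase.\<close>

lemma Moebius_function_has_field_derivative:
  assumes "1 - cnj w * z \<noteq> 0"
  shows "(Moebius_function 0 w has_field_derivative (1 - cnj w * w) / (1 - cnj w * z)\<^sup>2) (at z)"
  unfolding Moebius_function_simple[abs_def] using assms
  by (auto intro!: derivative_eq_intros simp: power2_eq_square algebra_simps)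

text \<open>Disk automorphisms carrying 0 to \<open>a\<close> and \<open>\<phi> a\<close> to 0 turn
  \<open>\<phi>\<close> into a self-map \<open>\<psi>\<close> of the disk fixing 0. The Schwarz
  lemma bounds \<open>deriv \<psi> 0\<close> by 1 in modulus, and the chain rule translates this
  bound into the claim.\<close>

lemma Schwarz_Pick:
  assumes hol: "\<phi> holomorphic_on unit_disk" and maps: "\<phi> ` unit_disk \<subseteq> unit_disk"
    and a: "a \<in> unit_disk"
  shows "(1 - (cmod a)\<^sup>2) * cmod (deriv \<phi> a) \<le> 1 - (cmod (\<phi> a))\<^sup>2"
proof -
  define b where "b = \<phi> a"
  define \<psi> where "\<psi> = Moebius_function 0 b \<circ> (\<phi> \<circ> Moebius_function 0 (- a))"
  have "b \<in> unit_disk" using a maps unfolding b_def by blast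
  then have b: "cmod b < 1" and a': "cmod a < 1" using a by simp_all
  \<comment> \<open>The factors from the Moebius derivatives are real; written this way, their
    moduli can be read off once \<open>pos\<close> gives the sign.\<close>
  have sq: "1 - cnj w * w = of_real (1 - (cmod w)\<^sup>2)" for w
    by (simp only: mult.commute[of "cnj w"] complex_norm_square[symmetric] of_real_diff of_real_1)
  have pos: "1 - (cmod w)\<^sup>2 > 0" if "cmod w < 1" for w
    using that by (simp add: power_less_one_iff)
  have Ma: "Moebius_function 0 (- a) ` unit_disk \<subseteq> unit_disk"
    using Moebius_function_norm_lt_1 a' by auto
  have hol\<psi>: "\<psi> holomorphic_on unit_disk"
    unfolding \<psi>_def
  proof (rule holomorphic_on_compose_gen)
    show "\<phi> \<circ> Moebius_function 0 (- a) holomorphic_on unit_disk"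
      using holomorphic_on_compose_gen[OF Moebius_function_holomorphic hol Ma] a' by simp
    show "Moebius_function 0 b holomorphic_on unit_disk"
      by (rule Moebius_function_holomorphic[OF b])
    show "(\<phi> \<circ> Moebius_function 0 (- a)) ` unit_disk \<subseteq> unit_disk"
      using Ma maps by (auto simp: image_subset_iff)
  qed
  have \<psi>0: "\<psi> 0 = 0"
    by (simp add: \<psi>_def Moebius_function_of_zero Moebius_function_eq_zero b_def)
  have \<psi>1: "cmod (\<psi> z) < 1" if "cmod z < 1" for z
  proof -
    have "cmod (\<phi> (Moebius_function 0 (- a) z)) < 1"
      using Ma maps that by (auto simp: image_subset_iff)
    then show ?thesis using Moebius_function_norm_lt_1[OF b] by (simp add: \<psi>_def)
  qed
  have nz: "1 - cnj b * b \<noteq> 0"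
    unfolding sq of_real_eq_0_iff using pos[OF b] by linarith
  \<comment> \<open>At the zero \<open>b\<close> of the outer automorphism the numerator cancels one
    factor of the squared denominator.\<close>
  have Mb: "(Moebius_function 0 b has_field_derivative 1 / (1 - cnj b * b))
      (at ((\<phi> \<circ> Moebius_function 0 (- a)) 0))"
    using Moebius_function_has_field_derivative[OF nz] nz
    by (simp add: Moebius_function_of_zero b_def power2_eq_square)
  have M0: "(Moebius_function 0 (- a) has_field_derivative 1 - cnj a * a) (at 0)"
    using Moebius_function_has_field_derivative[of "- a" 0] by simp
  have "(\<phi> has_field_derivative deriv \<phi> a) (at (Moebius_function 0 (- a) 0))"
    using holomorphic_derivI[OF hol open_ball a] by (simp add: Moebius_function_of_zero)
  from DERIV_chain[OF Mb DERIV_chain[OF this M0]]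
  have "deriv \<psi> 0 = 1 / (1 - cnj b * b) * (deriv \<phi> a * (1 - cnj a * a))"
    unfolding \<psi>_def by (rule DERIV_imp_deriv)
  then have "cmod (deriv \<psi> 0) = (1 - (cmod a)\<^sup>2) * cmod (deriv \<phi> a) / (1 - (cmod b)\<^sup>2)"
    unfolding sq using pos[OF a'] pos[OF b]
    by (simp add: norm_mult norm_divide mult.commute del: of_real_diff)
  with Schwarz_Lemma(2)[OF hol\<psi> \<psi>0 \<psi>1, of 0] pos[OF b] show ?thesis
    by (simp add: b_def)
qed

lemma canonical_decomp_parts:
  assumes "canonical_decomp f h g" "z \<in> unit_disk"
  shows "analytic_part f z = h z" "coanalytic_part f z = g z"
proof -
  obtain g' where "canonical_decomp f (analytic_part f) g'"
    unfolding analytic_part_def using assms(1) someI_ex[of "\<lambda>h. \<exists>g. canonical_decomp f h g"] by blast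
  then show "analytic_part f z = h z" using canonical_decomp_unique(1) assms by blast
  obtain h' where "canonical_decomp f h' (coanalytic_part f)"
    unfolding coanalytic_part_def using assms(1) someI_ex[of "\<lambda>g. \<exists>h. canonical_decomp f h g"] by blast
  then show "coanalytic_part f z = g z" using canonical_decomp_unique(2) assms by blast
qed

text \<open>The chosen parts are determined only on the disk. Since the disk is open, they agree
  with \<open>h\<close> and \<open>g\<close> near \<open>z\<close>, which is all that
  \<open>deriv\<close> sees.\<close>

lemma deriv_parts:
  assumes "canonical_decomp f h g" "z \<in> unit_disk"
  shows "deriv (analytic_part f) z = deriv h z" "deriv (coanalytic_part f) z = deriv g z"
proof -
  have "\<forall>\<^sub>F w in nhds z. w \<in> unit_disk"
    by (rule eventually_nhds_in_open[OF open_ball assms(2)])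
  then show "deriv (analytic_part f) z = deriv h z" "deriv (coanalytic_part f) z = deriv g z"
    by (auto intro!: deriv_cong_ev elim!: eventually_mono
        simp: canonical_decomp_parts[OF assms(1)])
qed

text \<open>As \<open>\<phi>\<close> may move 0, \<open>G \<circ> \<phi>\<close> need not vanish
  there. Subtracting \<open>G (\<phi> 0)\<close> restores the normalisation, and its conjugate goes
  into the analytic part to keep the sum unchanged.\<close>

lemma canonical_decomp_compose:
  assumes F: "canonical_decomp F H G"
    and hol: "\<phi> holomorphic_on unit_disk" and maps: "\<phi> ` unit_disk \<subseteq> unit_disk"
    and f: "\<forall>z\<in>unit_disk. f z = F (\<phi> z)"
  shows "canonical_decomp f (\<lambda>z. (H \<circ> \<phi>) z + cnj (G (\<phi> 0))) (\<lambda>z. (G \<circ> \<phi>) z - G (\<phi> 0))"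
proof -
  have "H \<circ> \<phi> holomorphic_on unit_disk" "G \<circ> \<phi> holomorphic_on unit_disk"
    using F holomorphic_on_compose_gen[OF hol _ maps] by (auto simp: canonical_decomp_def)
  moreover have "F (\<phi> z) = H (\<phi> z) + cnj (G (\<phi> z))" if "z \<in> unit_disk" for z
    using F maps that unfolding canonical_decomp_def by blast
  ultimately show ?thesis
    unfolding canonical_decomp_def
    by (auto intro!: holomorphic_on_add holomorphic_on_diff holomorphic_on_const simp: f comp_def)
qed

lemma deriv_parts_compose:
  assumes F: "harmonic_mapping F"
    and hol: "\<phi> holomorphic_on unit_disk" and maps: "\<phi> ` unit_disk \<subseteq> unit_disk"
    and f: "\<forall>z\<in>unit_disk. f z = F (\<phi> z)" and z: "z \<in> unit_disk"
  shows "deriv (analytic_part f) z = deriv (analytic_part F) (\<phi> z) * deriv \<phi> z"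
    and "deriv (coanalytic_part f) z = deriv (coanalytic_part F) (\<phi> z) * deriv \<phi> z"
proof -
  obtain H G where HG: "canonical_decomp F H G"
    using canonical_decomp_exists[OF F] by blast
  have \<phi>z: "\<phi> z \<in> unit_disk" using maps z by blast
  \<comment> \<open>The free constant \<open>c\<close> absorbs both normalising shifts:
    \<open>cnj (G (\<phi> 0))\<close> for the analytic part and \<open>- G (\<phi> 0)\<close> for
    the co-analytic one.\<close>
  have d: "((\<lambda>z. (K \<circ> \<phi>) z + c) has_field_derivative deriv K (\<phi> z) * deriv \<phi> z) (at z)"
    if "K holomorphic_on unit_disk" for K c
    using DERIV_add[OF DERIV_chain[OF holomorphic_derivI[OF that open_ball \<phi>z]
          holomorphic_derivI[OF hol open_ball z]] DERIV_const[of c]]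
    by simp
  note fd = deriv_parts[OF canonical_decomp_compose[OF HG hol maps f] z]
  note Fd = deriv_parts[OF HG \<phi>z]
  have hol': "H holomorphic_on unit_disk" "G holomorphic_on unit_disk"
    using HG by (auto simp: canonical_decomp_def)
  have "deriv (analytic_part f) z = deriv H (\<phi> z) * deriv \<phi> z"
    by (rule trans[OF fd(1) DERIV_imp_deriv[OF d[OF hol'(1)]]])
  then show "deriv (analytic_part f) z = deriv (analytic_part F) (\<phi> z) * deriv \<phi> z"
    by (simp only: Fd)
  have "deriv (coanalytic_part f) z = deriv G (\<phi> z) * deriv \<phi> z"
    using fd(2) DERIV_imp_deriv[OF d[OF hol'(2), of "- G (\<phi> 0)"]]
    by (simp only: diff_conv_add_uminus)
  then show "deriv (coanalytic_part f) z = deriv (coanalytic_part F) (\<phi> z) * deriv \<phi> z"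
    by (simp only: Fd)
qed

text \<open>The density is kept abstract so that one argument serves both the Bloch density and the
  root of the Jacobian. Nonnegativity of \<open>D\<close> allows Schwarz-Pick to be multiplied by
  it, so any bound for \<open>F\<close> is also one for \<open>f\<close>.\<close>

lemma bdd_above_density_compose:
  fixes d D :: "complex \<Rightarrow> real"
  assumes hol: "\<phi> holomorphic_on unit_disk" and maps: "\<phi> ` unit_disk \<subseteq> unit_disk"
    and eq: "\<And>z. z \<in> unit_disk \<Longrightarrow> d z = cmod (deriv \<phi> z) * D (\<phi> z)"
    and nonneg: "\<And>z. 0 \<le> D z"
    and bdd: "bdd_above ((\<lambda>z. (1 - (cmod z)\<^sup>2) * D z) ` unit_disk)"
  shows "bdd_above ((\<lambda>z. (1 - (cmod z)\<^sup>2) * d z) ` unit_disk)"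
proof -
  obtain M where M: "\<And>z. z \<in> unit_disk \<Longrightarrow> (1 - (cmod z)\<^sup>2) * D z \<le> M"
    using bdd unfolding bdd_above_def by blast
  have "(1 - (cmod z)\<^sup>2) * d z \<le> M" if z: "z \<in> unit_disk" for z
  proof -
    have "(1 - (cmod z)\<^sup>2) * d z = (1 - (cmod z)\<^sup>2) * cmod (deriv \<phi> z) * D (\<phi> z)"
      by (simp add: eq[OF z])
    also have "\<dots> \<le> (1 - (cmod (\<phi> z))\<^sup>2) * D (\<phi> z)"
      by (intro mult_right_mono Schwarz_Pick[OF hol maps z] nonneg)
    also have "\<dots> \<le> M" using M maps z by blast
    finally show ?thesis .
  qed
  then show ?thesis by (rule bdd_aboveI2)
qed

theorem theorem3:
  fixes f F :: "complex \<Rightarrow> complex"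
  assumes "harmonic_mapping f" and "harmonic_mapping F" and "f \<preceq> F"
  shows "(F \<in> harmonic_Bloch \<longrightarrow> f \<in> harmonic_Bloch) \<and>
         (F \<in> harmonic_Bloch_star \<longrightarrow> f \<in> harmonic_Bloch_star) \<and>
         (F \<in> analytic_Bloch \<longrightarrow> f \<in> analytic_Bloch)"
proof -
  obtain \<phi> where hol: "\<phi> holomorphic_on unit_disk" and maps: "\<phi> ` unit_disk \<subseteq> unit_disk"
    and f: "\<forall>z\<in>unit_disk. f z = F (\<phi> z)"
    using assms(3) by (auto simp: subordinate_def)
  note parts = deriv_parts_compose[OF assms(2) hol maps f]
  have "cmod (deriv (analytic_part f) z) + cmod (deriv (coanalytic_part f) z) =
      cmod (deriv \<phi> z) *
        (cmod (deriv (analytic_part F) (\<phi> z)) + cmod (deriv (coanalytic_part F) (\<phi> z)))"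
    if "z \<in> unit_disk" for z
    by (simp add: parts[OF that] norm_mult algebra_simps)
  from bdd_above_density_compose[OF hol maps this]
  have Bloch: "F \<in> harmonic_Bloch \<longrightarrow> f \<in> harmonic_Bloch"
    unfolding harmonic_Bloch_def using assms(1) by auto
  have "sqrt \<bar>harmonic_jacobian f z\<bar> = cmod (deriv \<phi> z) * sqrt \<bar>harmonic_jacobian F (\<phi> z)\<bar>"
    if "z \<in> unit_disk" for z
  proof -
    \<comment> \<open>Both squared moduli gain the same factor, hence so does their difference,
      whatever its sign; the root of the absolute value then scales by
      \<open>cmod (deriv \<phi> z)\<close>.\<close>
    have "harmonic_jacobian f z = (cmod (deriv \<phi> z))\<^sup>2 * harmonic_jacobian F (\<phi> z)"
      by (simp add: harmonic_jacobian_def parts[OF that] norm_mult power_mult_distrib algebra_simps)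
    then show ?thesis by (simp add: abs_mult real_sqrt_mult)
  qed
  then have Bloch_star: "F \<in> harmonic_Bloch_star \<longrightarrow> f \<in> harmonic_Bloch_star"
    unfolding harmonic_Bloch_star_def using assms(1)
    by (auto elim!: bdd_above_density_compose[OF hol maps, rotated -1])
  \<comment> \<open>Given the harmonic Bloch case, the analytic case lacks only holomorphy of
    \<open>f\<close>, inherited from the composition.\<close>
  have "f holomorphic_on unit_disk" if "F holomorphic_on unit_disk"
    by (rule holomorphic_transform[OF holomorphic_on_compose_gen[OF hol that maps]]) (simp add: f)
  with Bloch Bloch_star show ?thesis by (auto simp: analytic_Bloch_def)
qed

end
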